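(* Let $G$ be an arbitrary group (written additively, not necessarily abelian), let $m,n,\lambda$ be positive integers, let $\mathbf h=(h_1,\ldots,h_m)$ and $\mathbf k=(k_1,\ldots,k_n)$ be sequences of integers with $1\le h_i\le n$ and $1\le k_j\le m$ for all $i,j$, and let $S\subseteq G^+$ be such that $$|S\setminus I(S)|\ge m+n-1.$$ Then there exists a nonzero sum NGHA$^\lambda_S(m,n;\mathbf h,\mathbf k)$ over $G$ if and only if both of the following conditions hold: (i) $\lambda$ is even whenever $I(S)\neq\varnothing$, and $\lambda|S|-\frac{\lambda}{2}|I(S)|=h_1+\cdots+h_m=k_1+\cdots+k_n$; (ii) $\sum_{i=1}^m\min(h_i,u)\ge\sum_{j=1}^u k'_j$ for every $1\le u\le n$, where $(k'_1,\ldots,k'_n)$ is the decreasing (i.e. nonincreasing) reordering of $\mathbf k$.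
   Context: Let $G$ be an additive group, not necessarily abelian. Fix a map $\|\cdot\|:G\to G$ with $\|a\|=\|-a\|\in\{a,-a\}$ for every $a\in G$ (the absolute value). For a multiset $H$ of elements of $G$, $\|H\|$ is the multiset $\{\|h\|: h\in H\}$ and $H^+$ is the underlying set of $\|H\|$ minus the zero element; in particular $G^+=\{\|a\|: a\in G, a\ne 0\}$. For $S\subseteq G$, $I(S)$ is the set of elements of $S$ of order $2$. For a multiset $M$, ${}^\lambda M$ is the multiset union of $\lambda$ copies of $M$. For a matrix $A$ over $G$, $\mathcal E(A)$ is the multiset of its nonzero entries. For $S\subseteq G^+$, a generalized Heffter array GHA$^\lambda_S(m,n;\mathbf h,\mathbf k)$ over $G$ is an $m\times n$ matrix $H$ with entries from $G$ such that: (1) ${}^2\|\mathcal E(H)\|={}^{2\lambda}(S\setminus I(S))\cup{}^{\lambda}I(S)$ (equality of multisets); (2) the $i$-th row (resp. $j$-th column) of $H$ contains exactly $h_i$ (resp. $k_j$) nonzero elements, for all $i,j$. An ordering of a row (or column) is a sequence listing its nonzero entries (each position once). It is natural if it is obtained by cyclically sequencing from left to right (for rows) or from top to bottom (for columns) the nonzero entries starting from a given one. A natural ordering of a matrix is a choice of a natural ordering for each row and each column. An NGHA is a GHA endowed with a natural ordering. It is nonzero sum if, for every row and every column, the sum in $G$ of its nonzero entries, taken in the given order, is different from $0$. *)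

theory Defs
  imports "Jordan_Normal_Form.Matrix" "HOL-Library.Multiset"
begin

definition absolute_value :: "('a::group_add \<Rightarrow> 'a) \<Rightarrow> bool" where
  "absolute_value nrm \<longleftrightarrow> (\<forall>a. nrm a = nrm (- a) \<and> nrm a \<in> {a, - a})"

text \<open>The set \<open>G\<^sup>+\<close>, where \<open>G\<close> is the whole type.\<close>

definition pos_elems :: "('a::group_add \<Rightarrow> 'a) \<Rightarrow> 'a set" where
  "pos_elems nrm = {nrm a | a. a \<noteq> 0}"

text \<open>The set \<open>I(S)\<close> of the elements of \<open>S\<close> of order 2.\<close>

definition involutions :: "'a::group_add set \<Rightarrow> 'a set" where
  "involutions S = {x \<in> S. x \<noteq> 0 \<and> x + x = 0}"

definition nonzero_entries :: "'a::group_add mat \<Rightarrow> 'a multiset" where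
  "nonzero_entries A =
     filter_mset (\<lambda>x. x \<noteq> 0)
       (image_mset (\<lambda>(i, j). A $$ (i, j)) (mset_set ({..<dim_row A} \<times> {..<dim_col A})))"

text \<open>
  Generalized Heffter arrays. The sequences \<open>h\<close> and \<open>k\<close> are lists, indexed from 0.
  The multiset identity forces \<open>S\<close> to be finite, as a matrix has finitely many entries; this has
  to be said explicitly, since \<^const>\<open>mset_set\<close> maps infinite sets to the empty multiset.
\<close>

definition GHA ::
  "('a::group_add \<Rightarrow> 'a) \<Rightarrow> nat \<Rightarrow> 'a set \<Rightarrow> nat \<Rightarrow> nat \<Rightarrow> nat list \<Rightarrow> nat list \<Rightarrow> 'a mat \<Rightarrow> bool" where
  "GHA nrm l S m n h k H \<longleftrightarrow>
     H \<in> carrier_mat m n \<and>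
     finite S \<and>
     repeat_mset 2 (image_mset nrm (nonzero_entries H)) =
       repeat_mset (2 * l) (mset_set (S - involutions S)) + repeat_mset l (mset_set (involutions S)) \<and>
     (\<forall>i<m. card {j. j < n \<and> H $$ (i, j) \<noteq> 0} = h ! i) \<and>
     (\<forall>j<n. card {i. i < m \<and> H $$ (i, j) \<noteq> 0} = k ! j)"

text \<open>
  An ordering of a row (column) is given by the list of the column (row) indices of its nonzero
  entries. The \<open>filter\<close> lists these indices from left to right (top to bottom), and the rotation
  chooses the starting entry.
\<close>

definition natural_row_ordering :: "'a::group_add mat \<Rightarrow> nat \<Rightarrow> nat list \<Rightarrow> bool" where
  "natural_row_ordering A i js \<longleftrightarrow>
     (\<exists>c. js = rotate c (filter (\<lambda>j. A $$ (i, j) \<noteq> 0) [0..<dim_col A]))"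

definition natural_col_ordering :: "'a::group_add mat \<Rightarrow> nat \<Rightarrow> nat list \<Rightarrow> bool" where
  "natural_col_ordering A j ps \<longleftrightarrow>
     (\<exists>c. ps = rotate c (filter (\<lambda>i. A $$ (i, j) \<noteq> 0) [0..<dim_row A]))"

definition natural_ordering ::
  "'a::group_add mat \<Rightarrow> (nat \<Rightarrow> nat list) \<Rightarrow> (nat \<Rightarrow> nat list) \<Rightarrow> bool" where
  "natural_ordering A \<rho> \<gamma> \<longleftrightarrow>
     (\<forall>i<dim_row A. natural_row_ordering A i (\<rho> i)) \<and>
     (\<forall>j<dim_col A. natural_col_ordering A j (\<gamma> j))"

definition NGHA ::
  "('a::group_add \<Rightarrow> 'a) \<Rightarrow> nat \<Rightarrow> 'a set \<Rightarrow> nat \<Rightarrow> nat \<Rightarrow> nat list \<Rightarrow> nat list \<Rightarrow>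
   'a mat \<Rightarrow> (nat \<Rightarrow> nat list) \<Rightarrow> (nat \<Rightarrow> nat list) \<Rightarrow> bool" where
  "NGHA nrm l S m n h k H \<rho> \<gamma> \<longleftrightarrow> GHA nrm l S m n h k H \<and> natural_ordering H \<rho> \<gamma>"

definition nonzero_sum ::
  "'a::group_add mat \<Rightarrow> (nat \<Rightarrow> nat list) \<Rightarrow> (nat \<Rightarrow> nat list) \<Rightarrow> bool" where
  "nonzero_sum A \<rho> \<gamma> \<longleftrightarrow>
     (\<forall>i<dim_row A. sum_list (map (\<lambda>j. A $$ (i, j)) (\<rho> i)) \<noteq> 0) \<and>
     (\<forall>j<dim_col A. sum_list (map (\<lambda>i. A $$ (i, j)) (\<gamma> j)) \<noteq> 0)"

end

theory Submission
  imports Defs "HOL-Library.Product_Lexorder" "HOL-Combinatorics.Permutations"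
begin

text \<open>
  Conditions (i) and (ii) are equivalent to the numerical part of the multiset identity and, by the
  Gale-Ryser theorem, to the existence of a set of cells with the prescribed row and column counts.
  It remains to fill such a set \<open>E\<close> of cells. Whether the sum of a line vanishes depends only on its
  last entry once the others are known. Call a cell critical if it is the last one of its row or of
  its column. There are at most \<open>m + n - 1\<close> critical cells, because the last cell of the last row
  is critical for both its lines, so they can get distinct non-involutions of \<open>S\<close>; the other cells
  get the remaining elements in any way. The critical cells are filled in lexicographic order. As
  long as two reserved elements \<open>y\<close>, \<open>z\<close> are left, there are four candidates \<open>y, -y, z, -z\<close> and at
  most two of them are forbidden. The very last cell \<open>e\<close> is treated together with another cell \<open>f\<close>
  of the last row, which is critical for its column only; if there is none, the sum of the last row
  is a single nonzero entry, and the sign of the entry at \<open>e\<close> takes care of its column.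

  A rotation of a line conjugates its sum, so it suffices to sum from left to right and from top
  to bottom.
\<close>

section \<open>The Gale-Ryser theorem\<close>

text \<open>An entry moves from a column \<open>p\<close> that is too full to the first column \<open>q > p\<close> that is not full
  enough. Up to \<open>q\<close> no column is deficient, so the partial sums between \<open>p\<close> and \<open>q\<close> are strictly
  larger than required and survive the loss of one entry.\<close>

lemma shift_to_column_counts:
  fixes E :: "(nat \<times> nat) set" and k :: "nat \<Rightarrow> nat"
  assumes "E \<subseteq> {..<m} \<times> {..<n}"
    and "\<And>i j. i \<le> j \<Longrightarrow> j < n \<Longrightarrow> k j \<le> k i"
    and "\<And>u. u \<le> n \<Longrightarrow> sum k {..<u} \<le> (\<Sum>j<u. card {i. (i, j) \<in> E})"
    and "sum k {..<n} = (\<Sum>j<n. card {i. (i, j) \<in> E})"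
  shows "\<exists>F \<subseteq> {..<m} \<times> {..<n}. (\<forall>i. card {j. (i, j) \<in> F} = card {j. (i, j) \<in> E}) \<and>
    (\<forall>j<n. card {i. (i, j) \<in> F} = k j)"
  using assms(1,3,4)
\<comment> \<open>The measure is the total excess of the columns: truncated subtraction counts
  deficient columns as 0, and each move takes one unit off the excess of an overfull column.\<close>
proof (induction "\<Sum>j<n. card {i. (i, j) \<in> E} - k j" arbitrary: E rule: less_induct)
  case less
  define c where "c j = card {i. (i, j) \<in> E}" for j
  note dom = less.prems(2)[folded c_def] and total = less.prems(3)[folded c_def]
  have finE: "finite E" using less.prems(1) by (rule finite_subset) auto
  have fincol: "finite {i. (i, j) \<in> E}" for j
    by (rule finite_subset[of _ "fst ` E"]) (use finE in force)+
  have finrow: "finite {j. (i, j) \<in> E}" for i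
    by (rule finite_subset[of _ "snd ` E"]) (use finE in force)+
  show ?case
  proof (cases "\<forall>j<n. k j \<le> c j")
    case True
    have "\<forall>j\<in>{..<n}. k j = c j"
    proof (rule ccontr)
      assume "\<not> ?thesis"
      then have "sum k {..<n} < sum c {..<n}"
        using True by (intro sum_strict_mono_ex1) (force simp: order.strict_iff_order)+
      then show False using total by simp
    qed
    then show ?thesis using less.prems(1) by (intro exI[of _ E]) (auto simp: c_def)
  next
    case False
    define q where "q = (LEAST q. q < n \<and> c q < k q)"
    have q: "q < n" "c q < k q"
      using LeastI_ex[of "\<lambda>q. q < n \<and> c q < k q"] False by (auto simp: q_def not_le)
    have below_q: "k j \<le> c j" if "j < q" for j
      using not_less_Least[of j "\<lambda>q. q < n \<and> c q < k q"] that q(1) by (auto simp: q_def)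
    \<comment> \<open>If no column before \<open>q\<close> were overfull, the deficiency at
      \<open>q\<close> would make the partial sum up to and including \<open>q\<close> too
      small.\<close>
    obtain p where p: "p < q" "k p < c p"
    proof (rule ccontr)
      assume "\<not> thesis"
      then have "\<forall>j<q. c j \<le> k j" using that not_le by blast
      then have "sum c {..<Suc q} < sum k {..<Suc q}"
        using q(2) by (intro sum_strict_mono_ex1) (auto simp: less_Suc_eq)
      then show False using dom[of "Suc q"] q(1) by simp
    qed
    \<comment> \<open>Here \<open>c q < k q \<le> k p < c p\<close>, so some row meets column
      \<open>p\<close> but not column \<open>q\<close>. Moving the entry inside that row keeps all
      row counts.\<close>
    have "c q < c p" using p q assms(2)[of p q] by linarith
    then have "\<not> {i. (i, p) \<in> E} \<subseteq> {i. (i, q) \<in> E}"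
      using card_mono[OF fincol] unfolding c_def by (meson leD)
    then obtain i where i: "(i, p) \<in> E" "(i, q) \<notin> E" by blast
    define E' where "E' = insert (i, q) (E - {(i, p)})"
    define c' where "c' j = card {i. (i, j) \<in> E'}" for j
    have E'_sub: "E' \<subseteq> {..<m} \<times> {..<n}" using less.prems(1) i q(1) by (auto simp: E'_def)
    have col: "c' j + (if j = p then 1 else 0) = c j + (if j = q then 1 else 0)" for j
    proof -
      consider "j = p" | "j = q" | "j \<noteq> p" "j \<noteq> q" by blast
      then show ?thesis
      proof cases
        case 1
        then have "{i. (i, j) \<in> E'} = {i. (i, j) \<in> E} - {i}" using p(1) by (auto simp: E'_def)
        moreover have "card {i. (i, j) \<in> E} > 0" using i(1) fincol 1 by (auto simp: card_gt_0_iff)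
        ultimately show ?thesis using 1 p(1) i(1) fincol by (simp add: c_def c'_def)
      next
        case 2
        then have "{i. (i, j) \<in> E'} = insert i {i. (i, j) \<in> E}" using p(1) by (auto simp: E'_def)
        then show ?thesis using 2 p(1) i(2) fincol by (simp add: c_def c'_def)
      next
        case 3
        then have "{i. (i, j) \<in> E'} = {i. (i, j) \<in> E}" by (auto simp: E'_def)
        then show ?thesis using 3 by (simp add: c_def c'_def)
      qed
    qed
    have row: "card {j. (i', j) \<in> E'} = card {j. (i', j) \<in> E}" for i'
    proof (cases "i' = i")
      case True
      then have eq: "{j. (i', j) \<in> E'} = insert q ({j. (i', j) \<in> E} - {p})"
        using p(1) by (auto simp: E'_def)
      have "card {j. (i, j) \<in> E} > 0" using i(1) finrow by (auto simp: card_gt_0_iff)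
      then show ?thesis unfolding eq using True i finrow by simp
    next
      case False
      then show ?thesis by (auto simp: E'_def intro!: arg_cong[of _ _ card])
    qed
    have sums: "sum c' {..<u} + (if p < u then 1 else 0) = sum c {..<u} + (if q < u then 1 else 0)" for u
    proof -
      have "(\<Sum>j<u. c' j + (if j = p then 1 else 0)) = (\<Sum>j<u. c j + (if j = q then 1 else 0))"
        by (simp only: col)
      then show ?thesis by (simp add: sum.distrib)
    qed
    have dom': "sum k {..<u} \<le> sum c' {..<u}" if "u \<le> n" for u
    proof (cases "p < u \<and> u \<le> q")
      case True
      then have "sum k {..<u} < sum c {..<u}"
        using below_q p by (intro sum_strict_mono_ex1) auto
      then show ?thesis using sums[of u] True by simp
    next
      case False
      then show ?thesis using sums[of u] dom[OF that] p(1) by (auto split: if_splits)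
    qed
    have total': "sum k {..<n} = sum c' {..<n}" using sums[of n] total p q by simp
    have "(\<Sum>j<n. c' j - k j) < (\<Sum>j<n. c j - k j)"
    proof (rule sum_strict_mono_ex1)
      show "\<forall>j\<in>{..<n}. c' j - k j \<le> c j - k j"
      proof
        fix j
        show "c' j - k j \<le> c j - k j" using col[of j] q(2) by (auto split: if_splits)
      qed
      show "\<exists>j\<in>{..<n}. c' j - k j < c j - k j"
        using col[of p] p q(1) by (intro bexI[of _ p]) (auto split: if_splits)
    qed simp
    from less.hyps[OF this[unfolded c_def c'_def] E'_sub dom'[unfolded c'_def] total'[unfolded c'_def]]
    show ?thesis using row by simp
  qed
qed

lemma card_eq_sum_rows:
  fixes E :: "('a \<times> 'b) set"
  assumes "finite A" "finite B" "E \<subseteq> A \<times> B"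
  shows "card E = (\<Sum>i\<in>A. card {j. (i, j) \<in> E})"
proof -
  have "finite {j. (i, j) \<in> E}" for i
    by (rule finite_subset[OF _ assms(2)]) (use assms(3) in auto)
  then have "(\<Sum>i\<in>A. card {j. (i, j) \<in> E}) = card (SIGMA i:A. {j. (i, j) \<in> E})"
    using assms(1) by simp
  also have "(SIGMA i:A. {j. (i, j) \<in> E}) = E" using assms(3) by auto
  finally show ?thesis by simp
qed

lemma card_eq_sum_cols:
  fixes E :: "('a \<times> 'b) set"
  assumes "finite A" "finite B" "E \<subseteq> A \<times> B"
  shows "card E = (\<Sum>j\<in>B. card {i. (i, j) \<in> E})"
proof -
  have "card E = card (E\<inverse>)" by simp
  also have "\<dots> = (\<Sum>j\<in>B. card {i. (j, i) \<in> E\<inverse>})"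
    by (rule card_eq_sum_rows) (use assms in auto)
  finally show ?thesis by simp
qed

lemma rev_sort_eq_nth:
  obtains \<pi> where "\<pi> permutes {..<length k}" "\<And>j. j < length k \<Longrightarrow> rev (sort k) ! j = k ! \<pi> j"
proof -
  obtain \<pi> where \<pi>: "\<pi> permutes {..<length k}" "permute_list \<pi> k = rev (sort k)"
    using mset_eq_permutation[of "rev (sort k)" k] by auto
  then show ?thesis using that permute_list_nth[OF \<pi>(1)] by metis
qed

text \<open>Necessity counts the cells in the \<open>u\<close> columns with the largest prescribed
  counts row by row: a row has at most \<open>u\<close> of them and at most \<open>h ! i\<close>.
  Sufficiency repairs the left-justified diagram of \<open>h\<close> until its columns fit the
  sorted \<open>k\<close>, then permutes the columns back.\<close>

theorem gale_ryser:
  fixes h k :: "nat list"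
  assumes len: "length h = m" "length k = n" and h_le: "\<And>i. i < m \<Longrightarrow> h ! i \<le> n"
  shows "(\<exists>E \<subseteq> {..<m} \<times> {..<n}. (\<forall>i<m. card {j. (i, j) \<in> E} = h ! i) \<and>
      (\<forall>j<n. card {i. (i, j) \<in> E} = k ! j)) \<longleftrightarrow>
    (\<Sum>i<m. h ! i) = (\<Sum>j<n. k ! j) \<and>
    (\<forall>u. 1 \<le> u \<and> u \<le> n \<longrightarrow> (\<Sum>j<u. rev (sort k) ! j) \<le> (\<Sum>i<m. min (h ! i) u))"
    (is "?L \<longleftrightarrow> ?R")
proof -
  obtain \<pi> where \<pi>: "\<pi> permutes {..<n}" "\<And>j. j < n \<Longrightarrow> rev (sort k) ! j = k ! \<pi> j"
    using rev_sort_eq_nth[of k] len by metis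
  have \<pi>_lt: "\<pi> j < n \<longleftrightarrow> j < n" for j using permutes_in_image[OF \<pi>(1)] by simp
  have inj: "inj_on \<pi> X" for X using permutes_inj[OF \<pi>(1)] by (rule inj_on_subset) simp
  show ?thesis
  proof
    assume ?L
    then obtain E where E: "E \<subseteq> {..<m} \<times> {..<n}"
      "\<And>i. i < m \<Longrightarrow> card {j. (i, j) \<in> E} = h ! i" "\<And>j. j < n \<Longrightarrow> card {i. (i, j) \<in> E} = k ! j"
      by blast
    have "(\<Sum>j<u. rev (sort k) ! j) \<le> (\<Sum>i<m. min (h ! i) u)" if u: "u \<le> n" for u
    proof -
      define U where "U = \<pi> ` {..<u}"
      have U: "U \<subseteq> {..<n}" "card U = u" "finite U"
        using u \<pi>_lt inj by (auto simp: U_def card_image)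
      have "(\<Sum>j<u. rev (sort k) ! j) = (\<Sum>j\<in>U. k ! j)"
        unfolding U_def using u by (subst sum.reindex[OF inj]) (auto intro!: sum.cong \<pi>(2))
      also have "\<dots> = (\<Sum>j\<in>U. card {i. (i, j) \<in> E \<inter> {..<m} \<times> U})"
      proof (rule sum.cong[OF refl])
        fix j assume "j \<in> U"
        then have "{i. (i, j) \<in> E \<inter> {..<m} \<times> U} = {i. (i, j) \<in> E}" "j < n"
          using E(1) U(1) by auto
        then show "k ! j = card {i. (i, j) \<in> E \<inter> {..<m} \<times> U}" using E(3) by simp
      qed
      also have "\<dots> = card (E \<inter> {..<m} \<times> U)"
        using U by (intro card_eq_sum_cols[symmetric, of "{..<m}"]) auto
      also have "\<dots> = (\<Sum>i<m. card {j. (i, j) \<in> E \<inter> {..<m} \<times> U})"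
        using U by (intro card_eq_sum_rows[of _ U]) auto
      also have "\<dots> \<le> (\<Sum>i<m. min (h ! i) u)"
      proof (rule sum_mono)
        fix i assume "i \<in> {..<m}"
        then have i: "i < m" by simp
        have "finite {j. (i, j) \<in> E}" by (rule finite_subset[of _ "{..<n}"]) (use E(1) in auto)
        then have "card {j. (i, j) \<in> E \<inter> {..<m} \<times> U} \<le> h ! i"
          unfolding E(2)[OF i, symmetric] by (rule card_mono) auto
        moreover have "card {j. (i, j) \<in> E \<inter> {..<m} \<times> U} \<le> u"
          unfolding U(2)[symmetric] by (rule card_mono[OF U(3)]) auto
        ultimately show "card {j. (i, j) \<in> E \<inter> {..<m} \<times> U} \<le> min (h ! i) u" by simp
      qed
      finally show ?thesis .
    qed
    moreover have "(\<Sum>i<m. h ! i) = (\<Sum>j<n. k ! j)"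
      using card_eq_sum_rows[OF _ _ E(1)] card_eq_sum_cols[OF _ _ E(1)] E(2,3) by simp
    ultimately show ?R by blast
  next
    assume R: ?R
    \<comment> \<open>In the left-justified diagram the first \<open>u\<close> columns hold as many
      cells as the sum of all \<open>min (h ! i) u\<close>, so the inequalities are exactly the
      dominance that the shifting argument asks for.\<close>
    define E where "E = (SIGMA i:{..<m}. {..<h ! i})"
    have sub: "E \<subseteq> {..<m} \<times> {..<n}" using h_le by (force simp: E_def)
    have partial: "(\<Sum>j<u. card {i. (i, j) \<in> E}) = (\<Sum>i<m. min (h ! i) u)" for u
    proof -
      have "(\<Sum>j<u. card {i. (i, j) \<in> E}) = (\<Sum>j<u. card {i. (i, j) \<in> E \<inter> {..<m} \<times> {..<u}})"
        by (intro sum.cong arg_cong[of _ _ card]) (auto simp: E_def)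
      also have "\<dots> = (\<Sum>i<m. card {j. (i, j) \<in> E \<inter> {..<m} \<times> {..<u}})"
        using card_eq_sum_rows[of "{..<m}" "{..<u}" "E \<inter> {..<m} \<times> {..<u}"]
          card_eq_sum_cols[of "{..<m}" "{..<u}" "E \<inter> {..<m} \<times> {..<u}"] by simp
      also have "\<dots> = (\<Sum>i<m. card {..<min (h ! i) u})"
        by (intro sum.cong arg_cong[of _ _ card]) (auto simp: E_def)
      finally show ?thesis by simp
    qed
    define k' where "k' j = rev (sort k) ! j" for j
    have sum_k': "sum k' {..<n} = (\<Sum>j<n. k ! j)"
    proof -
      have "sum k' {..<n} = (\<Sum>j<n. k ! \<pi> j)" by (intro sum.cong) (auto simp: k'_def \<pi>(2))
      also have "\<dots> = (\<Sum>j<n. k ! j)" using sum.permute[OF \<pi>(1), of "\<lambda>j. k ! j"] by (simp add: o_def)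
      finally show ?thesis .
    qed
    have "\<exists>F \<subseteq> {..<m} \<times> {..<n}. (\<forall>i. card {j. (i, j) \<in> F} = card {j. (i, j) \<in> E}) \<and>
      (\<forall>j<n. card {i. (i, j) \<in> F} = k' j)"
    proof (rule shift_to_column_counts[OF sub])
      show "k' j \<le> k' i" if "i \<le> j" "j < n" for i j
        using that len by (auto simp: k'_def rev_nth intro!: sorted_nth_mono)
      show "sum k' {..<u} \<le> (\<Sum>j<u. card {i. (i, j) \<in> E})" if "u \<le> n" for u
        unfolding partial k'_def using R that by (cases "u = 0") auto
      show "sum k' {..<n} = (\<Sum>j<n. card {i. (i, j) \<in> E})"
        unfolding partial sum_k' using R h_le by (auto intro!: sum.cong simp: min_def)
    qed
    then obtain F where F: "F \<subseteq> {..<m} \<times> {..<n}"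
      "\<And>i. card {j. (i, j) \<in> F} = card {j. (i, j) \<in> E}" "\<And>j. j < n \<Longrightarrow> card {i. (i, j) \<in> F} = k' j"
      by blast
    \<comment> \<open>This undoes the sorting: column \<open>\<pi> j\<close> of \<open>F'\<close> is
      column \<open>j\<close> of \<open>F\<close>.\<close>
    define F' where "F' = {(i, j). (i, inv_into UNIV \<pi> j) \<in> F}"
    have inv_lt: "inv_into UNIV \<pi> j < n \<longleftrightarrow> j < n" for j
      using permutes_in_image[OF permutes_inv[OF \<pi>(1)]] by simp
    have "card {j. (i, j) \<in> F'} = h ! i" if "i < m" for i
    proof -
      have "{j. (i, j) \<in> F'} = \<pi> ` {j. (i, j) \<in> F}"
      proof (intro equalityI subsetI)
        fix j assume "j \<in> {j. (i, j) \<in> F'}"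
        then show "j \<in> \<pi> ` {j. (i, j) \<in> F}"
          using permutes_inverses(1)[OF \<pi>(1), of j] by (intro image_eqI) (auto simp: F'_def)
      qed (auto simp: F'_def permutes_inverses[OF \<pi>(1)])
      then have "card {j. (i, j) \<in> F'} = card {j. (i, j) \<in> E}" using inj F(2) by (simp add: card_image)
      also have "{j. (i, j) \<in> E} = {..<h ! i}" using that by (auto simp: E_def)
      finally show ?thesis by simp
    qed
    moreover have "card {i. (i, j) \<in> F'} = k ! j" if "j < n" for j
      using F(3)[of "inv_into UNIV \<pi> j"] that inv_lt \<pi>(2)[of "inv_into UNIV \<pi> j"] permutes_inverses[OF \<pi>(1)]
      by (simp add: F'_def k'_def)
    moreover have "F' \<subseteq> {..<m} \<times> {..<n}"
      using F(1) inv_lt by (auto simp: F'_def)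
    ultimately show ?L by blast
  qed
qed

section \<open>Filling the cells\<close>

lemma nrm_uminus_eq:
  assumes "absolute_value nrm" shows "nrm (- a) = nrm a"
  using assms by (simp add: absolute_value_def)

lemma nrm_pos_elem:
  assumes "absolute_value nrm" "x \<in> pos_elems nrm" shows "nrm x = x" "x \<noteq> 0"
proof -
  obtain a where a: "x = nrm a" "a \<noteq> 0" using assms(2) by (auto simp: pos_elems_def)
  have "nrm a = a \<or> nrm a = - a" using assms(1) by (auto simp: absolute_value_def)
  then show "nrm x = x" "x \<noteq> 0" using a nrm_uminus_eq[OF assms(1), of a] by auto
qed

lemma nrm_eq_0_iff:
  assumes "absolute_value nrm" shows "nrm a = 0 \<longleftrightarrow> a = 0"
proof -
  have "nrm a = a \<or> nrm a = - a" using assms by (auto simp: absolute_value_def)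
  then show ?thesis by auto
qed

lemma noninvolution_neq_uminus:
  fixes S :: "'a::group_add set"
  assumes "x \<in> S - involutions S" "x \<noteq> 0" shows "x \<noteq> - x"
  using assms by (auto simp: involutions_def eq_neg_iff_add_eq_0)

section \<open>Sums along a line and the choice of entries\<close>

lemma sum_list_map_cong:
  "(\<And>x. x \<in> set xs \<Longrightarrow> f x = g x) \<Longrightarrow> sum_list (map f xs) = sum_list (map g xs)"
  by (metis map_cong)

text \<open>The sum has the form \<open>a + (x + b)\<close>, with \<open>a\<close> and
  \<open>b\<close> coming from the entries before and after \<open>c\<close>. Cancelling on each
  side leaves only \<open>x = - a - b\<close>, also without commutativity. So a line forbids at most
  one value at each of its cells.\<close>

lemma line_sum_zero_unique:
  fixes A :: "'c \<Rightarrow> 'a::group_add"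
  assumes "distinct xs" "c \<in> set xs"
  obtains p where "\<And>x. sum_list (map (A(c := x)) xs) = 0 \<Longrightarrow> x = p"
proof -
  obtain us vs where xs: "xs = us @ c # vs" using assms(2) by (meson split_list)
  have notin: "c \<notin> set us" "c \<notin> set vs" using assms(1) xs by auto
  define a b where "a = sum_list (map A us)" and "b = sum_list (map A vs)"
  have "sum_list (map (A(c := x)) xs) = a + (x + b)" for x
    using notin sum_list_map_cong[of us "A(c := x)" A] sum_list_map_cong[of vs "A(c := x)" A]
    by (auto simp: xs a_def b_def)
  moreover have "x = - a - b" if "a + (x + b) = 0" for x
  proof -
    have "x + b = - a" using that minus_unique by metis
    then show ?thesis by (metis add_diff_cancel)
  qed
  ultimately show ?thesis using that by metis
qed

text \<open>\<open>nrm\<close> takes the value \<open>y\<close> on one pair of opposites and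
  \<open>z\<close> on the other, so the pairs are disjoint; neither pair collapses.\<close>

lemma four_signed_values:
  fixes nrm :: "'a::group_add \<Rightarrow> 'a"
  assumes "absolute_value nrm" "nrm y = y" "nrm z = z" "y \<noteq> z" "y \<noteq> - y" "z \<noteq> - z"
  shows "card {y, - y, z, - z} = 4"
proof -
  have "nrm (- y) = y" "nrm (- z) = z" using assms by (simp_all add: nrm_uminus_eq)
  then have "y \<noteq> - z" "- y \<noteq> z" "- y \<noteq> - z" using assms(2-4) by metis+
  then show ?thesis using assms(4-6) by simp
qed

text \<open>\<open>L c\<close> holds the lines to be settled at \<open>c\<close>. Later cells of
  \<open>cs\<close> avoid these lines, so a sum made nonzero at \<open>c\<close> stays nonzero. At
  each step at least two elements of \<open>T\<close> are left, which gives four signed values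
  against at most two forbidden ones.\<close>

lemma greedy_filling:
  fixes nrm :: "'a::group_add \<Rightarrow> 'a" and A :: "'c \<Rightarrow> 'a"
  assumes "absolute_value nrm" "distinct cs" "finite T" "length cs < card T"
    and "\<And>t. t \<in> T \<Longrightarrow> nrm t = t \<and> t \<noteq> - t"
    and "\<And>c. c \<in> set cs \<Longrightarrow> finite (L c) \<and> card (L c) \<le> 2 \<and> (\<forall>xs\<in>L c. distinct xs \<and> c \<in> set xs)"
    and "sorted_wrt (\<lambda>c d. \<forall>xs\<in>L c. d \<notin> set xs) cs"
  shows "\<exists>B. (\<forall>c. c \<notin> set cs \<longrightarrow> B c = A c) \<and> inj_on (\<lambda>c. nrm (B c)) (set cs) \<and>
    (\<lambda>c. nrm (B c)) ` set cs \<subseteq> T \<and> (\<forall>c\<in>set cs. \<forall>xs\<in>L c. sum_list (map B xs) \<noteq> 0)"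
  using assms(2-)
proof (induction cs arbitrary: A T)
  case Nil
  then show ?case by auto
next
  case (Cons c cs)
  have "\<not> card T \<le> Suc 0" using Cons.prems(3) by simp
  then obtain y z where yz: "y \<in> T" "z \<in> T" "y \<noteq> z"
    unfolding card_le_Suc0_iff_eq[OF Cons.prems(2)] by blast
  have "\<forall>xs. \<exists>p. xs \<in> L c \<longrightarrow> (\<forall>x. sum_list (map (A(c := x)) xs) = 0 \<longrightarrow> x = p)"
    using Cons.prems(5)[of c] line_sum_zero_unique by (metis list.set_intros(1))
  then obtain p where p: "\<And>xs x. xs \<in> L c \<Longrightarrow> sum_list (map (A(c := x)) xs) = 0 \<Longrightarrow> x = p xs"
    by metis
  have Lc: "finite (L c)" "card (L c) \<le> 2" using Cons.prems(5)[of c] by auto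
  have "card (p ` L c) \<le> 2" using card_image_le[OF Lc(1)] Lc(2) by (rule order.trans)
  moreover have "card {y, - y, z, - z} = 4"
    using four_signed_values[OF assms(1), of y z] yz Cons.prems(4) by blast
  ultimately have "\<not> {y, - y, z, - z} \<subseteq> p ` L c"
    using Lc(1) card_mono[of "p ` L c" "{y, - y, z, - z}"] by auto
  then obtain x where x: "x \<in> {y, - y, z, - z}" "x \<notin> p ` L c" by blast
  have xT: "nrm x \<in> T" using x(1) yz Cons.prems(4) nrm_uminus_eq[OF assms(1)] by auto
  \<comment> \<open>Removing \<open>nrm x\<close> from the reserve keeps the absolute values of the
    later entries different from that of \<open>x\<close>.\<close>
  have "\<exists>B. (\<forall>d. d \<notin> set cs \<longrightarrow> B d = (A(c := x)) d) \<and> inj_on (\<lambda>d. nrm (B d)) (set cs) \<and>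
    (\<lambda>d. nrm (B d)) ` set cs \<subseteq> T - {nrm x} \<and> (\<forall>d\<in>set cs. \<forall>xs\<in>L d. sum_list (map B xs) \<noteq> 0)"
  proof (rule Cons.IH)
    show "length cs < card (T - {nrm x})" using Cons.prems(2,3) xT by simp
    show "sorted_wrt (\<lambda>c d. \<forall>xs\<in>L c. d \<notin> set xs) cs" using Cons.prems(6) by simp
    show "finite (L d) \<and> card (L d) \<le> 2 \<and> (\<forall>xs\<in>L d. distinct xs \<and> d \<in> set xs)"
      if "d \<in> set cs" for d using Cons.prems(5) that by (meson list.set_intros(2))
    show "distinct cs" "finite (T - {nrm x})" using Cons.prems(1,2) by simp_all
    show "nrm t = t \<and> t \<noteq> - t" if "t \<in> T - {nrm x}" for t using Cons.prems(4) that by blast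
  qed
  then obtain B where B: "\<And>d. d \<notin> set cs \<Longrightarrow> B d = (A(c := x)) d" "inj_on (\<lambda>d. nrm (B d)) (set cs)"
    "(\<lambda>d. nrm (B d)) ` set cs \<subseteq> T - {nrm x}" "\<forall>d\<in>set cs. \<forall>xs\<in>L d. sum_list (map B xs) \<noteq> 0"
    by blast
  have Bc: "B c = x" using B(1)[of c] Cons.prems(1) by simp
  have "sum_list (map B xs) \<noteq> 0" if "xs \<in> L c" for xs
  proof -
    have "sum_list (map B xs) = sum_list (map (A(c := x)) xs)"
      using Cons.prems(6) that by (intro sum_list_map_cong B(1)) auto
    then show ?thesis using p[OF that] x(2) that by auto
  qed
  moreover have "\<forall>d. d \<notin> set (c # cs) \<longrightarrow> B d = A d" using B(1) by auto
  moreover have "inj_on (\<lambda>d. nrm (B d)) (set (c # cs))" using B(2,3) Bc Cons.prems(1) by auto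
  moreover have "(\<lambda>d. nrm (B d)) ` set (c # cs) \<subseteq> T" using B(3) Bc xT by auto
  ultimately show ?case using B(4) by (intro exI[of _ B]) auto
qed

text \<open>The sum of \<open>V\<close> does not depend on the entry at \<open>f\<close> and forbids a single value at \<open>e\<close>, which
  is up to sign at most one of \<open>y\<close> and \<open>z\<close>. The other one goes to \<open>e\<close>, and its sign is still free
  to take care of the sum of \<open>R\<close>.\<close>

lemma last_two_entries:
  fixes nrm :: "'a::group_add \<Rightarrow> 'a" and A :: "'c \<Rightarrow> 'a"
  assumes nrm: "absolute_value nrm"
    and yz: "nrm y = y" "nrm z = z" "y \<noteq> z" "y \<noteq> - y" "z \<noteq> - z"
    and R: "distinct R" "e \<in> set R"
    and W: "distinct W" "f \<in> set W" "e \<notin> set W"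
    and V: "distinct V" "e \<in> set V" "f \<notin> set V"
  shows "\<exists>a b. {nrm a, nrm b} = {y, z} \<and> sum_list (map (A(f := a, e := b)) R) \<noteq> 0 \<and>
    sum_list (map (A(f := a, e := b)) W) \<noteq> 0 \<and> sum_list (map (A(f := a, e := b)) V) \<noteq> 0"
proof -
  obtain q where q: "\<And>b. sum_list (map (A(e := b)) V) = 0 \<Longrightarrow> b = q"
    using line_sum_zero_unique[OF V(1,2), of A] by blast
  obtain s where s: "\<And>a. sum_list (map (A(f := a)) W) = 0 \<Longrightarrow> a = s"
    using line_sum_zero_unique[OF W(1,2), of A] by blast
  obtain t u where tu: "{t, u} = {y, z}" "q \<notin> {u, - u}"
  proof (cases "q \<in> {z, - z}")
    case True
    then have "nrm q = z" using yz(2) nrm_uminus_eq[OF nrm] by auto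
    then have "q \<notin> {y, - y}" using yz(1,3) nrm_uminus_eq[OF nrm] by auto
    then show ?thesis using that[of z y] by auto
  qed (use that[of y z] in auto)
  have props: "nrm t = t" "nrm u = u" "t \<noteq> - t" "u \<noteq> - u" using tu(1) yz by (auto simp: doubleton_eq_iff)
  \<comment> \<open>The sign at \<open>f\<close> is spent on \<open>W\<close>, whose sum does not
    involve \<open>e\<close>. Once \<open>a\<close> is fixed, \<open>R\<close> forbids a single
    value at \<open>e\<close>.\<close>
  obtain a where a: "a \<in> {t, - t}" "a \<noteq> s" using props(3) by blast
  obtain r where r: "\<And>b. sum_list (map (A(f := a, e := b)) R) = 0 \<Longrightarrow> b = r"
    using line_sum_zero_unique[OF R, of "A(f := a)"] by blast
  obtain b where b: "b \<in> {u, - u}" "b \<noteq> r" using props(4) by blast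
  have "nrm a = t" "nrm b = u" using a b props nrm_uminus_eq[OF nrm] by auto
  moreover have "sum_list (map (A(f := a, e := b)) W) = sum_list (map (A(f := a)) W)"
    "sum_list (map (A(f := a, e := b)) V) = sum_list (map (A(e := b)) V)"
    using W(3) V(3) by (auto intro!: sum_list_map_cong)
  ultimately show ?thesis using tu a b r s q by (intro exI[of _ a] exI[of _ b]) auto
qed

text \<open>This serves to spread the elements not reserved for critical cells over the other cells,
  in no particular way.\<close>

lemma ex_image_mset_eq:
  assumes "finite X" "size M = card X"
  shows "\<exists>f. image_mset f (mset_set X) = M"
  using assms
proof (induction X arbitrary: M rule: finite_induct)
  case (insert x X)
  then have "size M = Suc (card X)" by simp
  then obtain a N where M: "M = add_mset a N" using size_eq_Suc_imp_eq_union by blast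
  then obtain f where f: "image_mset f (mset_set X) = N" using insert by auto
  define g where "g = f(x := a)"
  have "image_mset g (mset_set X) = image_mset f (mset_set X)"
    using insert.hyps by (intro image_mset_cong) (auto simp: g_def)
  moreover have "g x = a" by (simp add: g_def)
  ultimately show ?case using insert.hyps M f by (intro exI[of _ g]) simp
qed auto

section \<open>Rows, columns and critical cells\<close>

text \<open>Lines are lists of cells rather than of indices, so that rows and columns are objects of
  one kind; the list keeps the order of summation.\<close>

definition row_line :: "(nat \<times> nat) set \<Rightarrow> nat \<Rightarrow> nat \<Rightarrow> (nat \<times> nat) list" where
  "row_line E n i = map (\<lambda>j. (i, j)) (filter (\<lambda>j. (i, j) \<in> E) [0..<n])"

definition col_line :: "(nat \<times> nat) set \<Rightarrow> nat \<Rightarrow> nat \<Rightarrow> (nat \<times> nat) list" where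
  "col_line E m j = map (\<lambda>i. (i, j)) (filter (\<lambda>i. (i, j) \<in> E) [0..<m])"

lemma set_row_line: "set (row_line E n i) = {c \<in> E. fst c = i \<and> snd c < n}"
  by (auto simp: row_line_def)

lemma set_col_line: "set (col_line E m j) = {c \<in> E. snd c = j \<and> fst c < m}"
  by (auto simp: col_line_def)

lemma distinct_lines: "distinct (row_line E n i)" "distinct (col_line E m j)"
  by (auto simp: row_line_def col_line_def distinct_map inj_on_def)

definition last_in_row :: "(nat \<times> nat) set \<Rightarrow> nat \<times> nat \<Rightarrow> bool" where
  "last_in_row E c \<longleftrightarrow> (\<forall>j. (fst c, j) \<in> E \<longrightarrow> j \<le> snd c)"

definition last_in_col :: "(nat \<times> nat) set \<Rightarrow> nat \<times> nat \<Rightarrow> bool" where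
  "last_in_col E c \<longleftrightarrow> (\<forall>i. (i, snd c) \<in> E \<longrightarrow> i \<le> fst c)"

text \<open>\<open>M\<close> is the multiset of absolute values to be placed, and \<open>T\<close>
  is the reserve for the critical cells. The inclusion of \<open>mset_set T\<close> in
  \<open>M\<close> sets aside one copy of each reserved element; the remaining copies fill the other
  cells.\<close>

lemma nonzero_sum_filling:
  fixes nrm :: "'a::group_add \<Rightarrow> 'a" and E :: "(nat \<times> nat) set"
  assumes nrm: "absolute_value nrm" and m: "m > 0"
    and E: "E \<subseteq> {..<m} \<times> {..<n}"
    and rows: "\<And>i. i < m \<Longrightarrow> \<exists>j. (i, j) \<in> E" and cols: "\<And>j. j < n \<Longrightarrow> \<exists>i. (i, j) \<in> E"
    and M: "size M = card E" "\<And>x. x \<in># M \<Longrightarrow> nrm x = x"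
    and T: "mset_set T \<subseteq># M" "finite T" "card T \<ge> m + n - 1" "\<And>t. t \<in> T \<Longrightarrow> t \<noteq> - t"
  shows "\<exists>A. image_mset (\<lambda>c. nrm (A c)) (mset_set E) = M \<and>
    (\<forall>i<m. sum_list (map A (row_line E n i)) \<noteq> 0) \<and> (\<forall>j<n. sum_list (map A (col_line E m j)) \<noteq> 0)"
proof -
  have finE: "finite E" using E by (rule finite_subset) auto
  have in_rl: "c \<in> set (row_line E n i) \<longleftrightarrow> c \<in> E \<and> fst c = i"
    and in_cl: "c \<in> set (col_line E m j) \<longleftrightarrow> c \<in> E \<and> snd c = j" for c i j
    using E by (auto simp: set_row_line set_col_line)
  define r where "r i = (i, Max {j. (i, j) \<in> E})" for i
  define c where "c j = (Max {i. (i, j) \<in> E}, j)" for j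
  have finrow: "finite {j. (i, j) \<in> E}" and fincol: "finite {j'. (j', i) \<in> E}" for i
    by (rule finite_subset[of _ "{..<n}"] finite_subset[of _ "{..<m}"]; use E in auto)+
  have r: "r i \<in> E" "last_in_row E (r i)" if "i < m" for i
    using Max_in[OF finrow, of i] Max_ge[OF finrow, of _ i] rows[OF that]
    by (auto simp: r_def last_in_row_def)
  have c: "c j \<in> E" "last_in_col E (c j)" if "j < n" for j
    using Max_in[OF fincol, of j] Max_ge[OF fincol, of _ j] cols[OF that]
    by (auto simp: c_def last_in_col_def)
  have r_eq: "r (fst x) = x" if "x \<in> E" "last_in_row E x" for x
  proof -
    have "Max {j. (fst x, j) \<in> E} = snd x"
      by (rule Max_eqI[OF finrow]) (use that in \<open>auto simp: last_in_row_def\<close>)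
    then show ?thesis by (simp add: r_def)
  qed
  have c_eq: "c (snd x) = x" if "x \<in> E" "last_in_col E x" for x
  proof -
    have "Max {i. (i, snd x) \<in> E} = fst x"
      by (rule Max_eqI[OF fincol]) (use that in \<open>auto simp: last_in_col_def\<close>)
    then show ?thesis by (simp add: c_def)
  qed
  define C where "C = {x \<in> E. last_in_row E x \<or> last_in_col E x}"
  have finC: "finite C" using finE by (simp add: C_def)
  define L where "L x = (if last_in_row E x then {row_line E n (fst x)} else {}) \<union>
      (if last_in_col E x then {col_line E m (snd x)} else {})" for x
  have L: "finite (L x) \<and> card (L x) \<le> 2 \<and> (\<forall>xs\<in>L x. distinct xs \<and> x \<in> set xs)" if "x \<in> E" for x
    using that by (auto simp: L_def in_rl in_cl distinct_lines card_insert_if)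
  \<comment> \<open>A cell of \<open>E\<close> beyond \<open>x\<close> in lexicographic order would
    follow \<open>x\<close> on any line they share, but the lines in \<open>L x\<close> end at
    \<open>x\<close>.\<close>
  have later: "y \<notin> set xs" if "x < y" "xs \<in> L x" "y \<in> E" for x y xs
    using that by (cases x; cases y)
      (auto simp: L_def in_rl in_cl last_in_row_def last_in_col_def split: if_splits)
  define e where "e = r (m - 1)"
  have e: "e \<in> E" "last_in_row E e" "fst e = m - 1" "last_in_col E e" "snd e < n"
    using r[of "m - 1"] m E by (auto simp: e_def r_def last_in_col_def)
  have eC: "e \<in> C" using e by (simp add: C_def)
  have e_eq: "r (fst e) = e" "c (snd e) = e" using r_eq c_eq e by blast+
  \<comment> \<open>Besides \<open>e\<close>, a critical cell ends one of the other
    \<open>m - 1\<close> rows or one of the \<open>n - 1\<close> columns other than that of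
    \<open>e\<close>.\<close>
  have "C \<subseteq> insert e (r ` {..<m - 1} \<union> c ` ({..<n} - {snd e}))"
  proof
    fix x assume "x \<in> C"
    then have x: "x \<in> E" "last_in_row E x \<or> last_in_col E x" by (auto simp: C_def)
    then have lt: "fst x < m" "snd x < n" using E by auto
    show "x \<in> insert e (r ` {..<m - 1} \<union> c ` ({..<n} - {snd e}))"
    proof (cases "last_in_row E x")
      case True
      then have "x = r (fst x)" using r_eq x by simp
      then show ?thesis using lt by (cases "fst x = m - 1") (auto simp: e_def)
    next
      case False
      then have "x = c (snd x)" using c_eq x by simp
      moreover have "c (snd e) = e" using c_eq e by simp
      ultimately show ?thesis using lt by (cases "snd x = snd e") auto
    qed
  qed
  then have "card C \<le> card (insert e (r ` {..<m - 1} \<union> c ` ({..<n} - {snd e})))"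
    by (intro card_mono) auto
  also have "\<dots> \<le> Suc (card (r ` {..<m - 1} \<union> c ` ({..<n} - {snd e})))" by (rule card_insert_le_m1) auto
  also have "\<dots> \<le> Suc (card (r ` {..<m - 1}) + card (c ` ({..<n} - {snd e})))"
    by (simp add: card_Un_le)
  also have "\<dots> \<le> Suc ((m - 1) + (n - 1))"
    using card_image_le[of "{..<m - 1}" r] card_image_le[of "{..<n} - {snd e}" c] e(5)
    by (simp add: add_mono)
  \<comment> \<open>As \<open>m > 0\<close> and \<open>snd e < n\<close>, no subtraction is
    truncated and the bound is \<open>m + n - 1\<close>.\<close>
  also have "\<dots> \<le> card T" using T(3) m e(5) by simp
  \<comment> \<open>The reserve is cut down to one value per critical cell, so that an injective
    filling uses all of it.\<close>
  finally obtain T' where T': "T' \<subseteq> T" "card T' = card C" by (meson obtain_subset_with_card_n)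
  have finT': "finite T'" using T' T(2) finite_subset by blast
  have subM: "mset_set T' \<subseteq># M"
    using T(1) T' T(2) by (meson subset_imp_msubset_mset_set subset_mset.trans)
  have T'p: "nrm t = t \<and> t \<noteq> - t" if "t \<in> T'" for t
  proof -
    have "t \<in># mset_set T'" using that finT' by simp
    then show ?thesis using M(2) subM T(4) T'(1) that by (meson mset_subset_eqD subsetD)
  qed
  have "size (M - mset_set T') = card (E - C)"
    using M(1) T'(2) subM finC by (simp add: size_Diff_submset C_def card_Diff_subset)
  \<comment> \<open>On \<open>C\<close> the values of \<open>A0\<close> are placeholders, to be
    overwritten later.\<close>
  then obtain A0 where A0: "image_mset A0 (mset_set (E - C)) = M - mset_set T'"
    using ex_image_mset_eq[of "E - C" "M - mset_set T'"] finE by auto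
  \<comment> \<open>Properness of \<open>D\<close> leaves a spare value in \<open>T'\<close>, which
    supplies the second candidate even at the last greedy step.\<close>
  have greedy: "\<exists>B. (\<forall>x. x \<notin> D \<longrightarrow> B x = A0 x) \<and> inj_on (\<lambda>x. nrm (B x)) D \<and>
    (\<lambda>x. nrm (B x)) ` D \<subseteq> T' \<and> (\<forall>x\<in>D. \<forall>xs\<in>L x. sum_list (map B xs) \<noteq> 0)" if "D \<subset> C" for D
  proof -
    have finD: "finite D" using that finC finite_subset by blast
    have "sorted_wrt (\<lambda>x y. \<forall>xs\<in>L x. y \<notin> set xs) (sorted_list_of_set D)"
      by (rule sorted_wrt_mono_rel[OF _ strict_sorted_list_of_set])
        (use later that finD in \<open>auto simp: C_def\<close>)
    moreover have "length (sorted_list_of_set D) < card T'"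
      using psubset_card_mono[OF finC that] T'(2) by simp
    moreover have "finite (L x) \<and> card (L x) \<le> 2 \<and> (\<forall>xs\<in>L x. distinct xs \<and> x \<in> set xs)"
      if "x \<in> set (sorted_list_of_set D)" for x
      using that \<open>D \<subset> C\<close> finD by (intro L) (auto simp: C_def)
    ultimately have "\<exists>B. (\<forall>x. x \<notin> set (sorted_list_of_set D) \<longrightarrow> B x = A0 x) \<and>
      inj_on (\<lambda>x. nrm (B x)) (set (sorted_list_of_set D)) \<and>
      (\<lambda>x. nrm (B x)) ` set (sorted_list_of_set D) \<subseteq> T' \<and>
      (\<forall>x\<in>set (sorted_list_of_set D). \<forall>xs\<in>L x. sum_list (map B xs) \<noteq> 0)"
      by (intro greedy_filling[OF nrm _ finT' _ T'p]) auto
    then show ?thesis using finD by simp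
  qed
  have "\<exists>A. (\<forall>x\<in>E - C. A x = A0 x) \<and> inj_on (\<lambda>x. nrm (A x)) C \<and> (\<lambda>x. nrm (A x)) ` C \<subseteq> T' \<and>
    (\<forall>x\<in>C. \<forall>xs\<in>L x. sum_list (map A xs) \<noteq> 0)"
  proof (cases "\<exists>w. w \<noteq> snd e \<and> (m - 1, w) \<in> E")
    case True
    then obtain w where w: "w \<noteq> snd e" "(m - 1, w) \<in> E" by blast
    define f where "f = (m - 1, w)"
    have f: "f \<in> E" "fst f = m - 1" "snd f \<noteq> snd e" "f \<noteq> e" "last_in_col E f"
      using w E e by (auto simp: f_def last_in_col_def)
    have f_row: "\<not> last_in_row E f"
      using r_eq[of f] f by (auto simp: e_def)
    have fC: "f \<in> C" using f by (simp add: C_def)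
    define D where "D = C - {e, f}"
    have "D \<subset> C" using eC by (auto simp: D_def)
    obtain B where B: "\<And>x. x \<notin> D \<Longrightarrow> B x = A0 x" "inj_on (\<lambda>x. nrm (B x)) D"
      "(\<lambda>x. nrm (B x)) ` D \<subseteq> T'" "\<forall>x\<in>D. \<forall>xs\<in>L x. sum_list (map B xs) \<noteq> 0"
      using greedy[OF \<open>D \<subset> C\<close>] by blast
    have "card (T' - (\<lambda>x. nrm (B x)) ` D) = card T' - card D"
      using B(2,3) finT' by (simp add: card_Diff_subset card_image finite_subset)
    also have "card D = card C - 2" using eC fC f(4) finC by (simp add: D_def card_Diff_subset)
    also have "card T' - (card C - 2) = 2"
      using T'(2) card_mono[OF finC, of "{e, f}"] eC fC f(4) by simp
    finally obtain y z where yz: "T' - (\<lambda>x. nrm (B x)) ` D = {y, z}" "y \<noteq> z" by (auto simp: card_2_iff)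
    then have yzT: "y \<in> T'" "z \<in> T'" by auto
    \<comment> \<open>\<open>R\<close> is the last row, \<open>W\<close> the column of
      \<open>f\<close> and \<open>V\<close> the column of \<open>e\<close>; these columns differ, so
      each avoids the other cell.\<close>
    have "\<exists>a b. {nrm a, nrm b} = {y, z} \<and> sum_list (map (B(f := a, e := b)) (row_line E n (m - 1))) \<noteq> 0 \<and>
      sum_list (map (B(f := a, e := b)) (col_line E m (snd f))) \<noteq> 0 \<and>
      sum_list (map (B(f := a, e := b)) (col_line E m (snd e))) \<noteq> 0"
      using yz(2) T'p yzT e f
      by (intro last_two_entries[OF nrm]) (auto simp: in_rl in_cl distinct_lines)
    then obtain a b where ab: "{nrm a, nrm b} = {y, z}"
      "sum_list (map (B(f := a, e := b)) (row_line E n (m - 1))) \<noteq> 0"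
      "sum_list (map (B(f := a, e := b)) (col_line E m (snd f))) \<noteq> 0"
      "sum_list (map (B(f := a, e := b)) (col_line E m (snd e))) \<noteq> 0" by blast
    define A where "A = B(f := a, e := b)"
    have AD: "A x = B x" if "x \<noteq> e" "x \<noteq> f" for x using that by (simp add: A_def)
    have Aef: "nrm (A f) = nrm a" "nrm (A e) = nrm b" using f(4) by (simp_all add: A_def)
    have CD: "C = insert e (insert f D)" using eC fC by (auto simp: D_def)
    have imD: "(\<lambda>x. nrm (A x)) ` D = (\<lambda>x. nrm (B x)) ` D" using AD by (auto simp: D_def image_iff)
    have "inj_on (\<lambda>x. nrm (A x)) D"
      using B(2) AD by (subst inj_on_cong[of _ _ "\<lambda>x. nrm (B x)"]) (auto simp: D_def)
    moreover have "nrm a \<noteq> nrm b" using ab(1) yz(2) by auto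
    moreover have "nrm a \<in> T' - (\<lambda>x. nrm (B x)) ` D" "nrm b \<in> T' - (\<lambda>x. nrm (B x)) ` D"
      unfolding yz(1) using ab(1) by auto
    moreover have "insert f D - {e} = insert f D" "D - {f} = D" using f(4) by (auto simp: D_def)
    ultimately have "inj_on (\<lambda>x. nrm (A x)) C" "(\<lambda>x. nrm (A x)) ` C \<subseteq> T'"
      using B(3) by (simp_all add: CD inj_on_insert Aef imD)
    moreover have "A x = A0 x" if "x \<in> E - C" for x
      using that B(1)[of x] AD[of x] eC fC by (auto simp: D_def)
    moreover have "sum_list (map A xs) \<noteq> 0" if xs: "x \<in> C" "xs \<in> L x" for x xs
    proof -
      consider "x = e" | "x = f" | "x \<in> D" using xs(1) unfolding CD by blast
      then show ?thesis
      proof cases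
        case 1
        then show ?thesis using xs(2) ab(2,4) e by (auto simp: L_def A_def)
      next
        case 2
        then show ?thesis using xs(2) ab(3) f f_row by (auto simp: L_def A_def)
      next
        case 3
        then have x: "x \<in> E" "x \<noteq> e" "x \<noteq> f" using xs(1) by (auto simp: C_def D_def)
        \<comment> \<open>The last row and the column of \<open>e\<close> end at \<open>e\<close>,
          and the column of \<open>f\<close> ends at \<open>f\<close>. A line ending elsewhere
          therefore misses both cells and keeps its greedy sum.\<close>
        have "e \<notin> set xs \<and> f \<notin> set xs"
          using x xs(2) e_eq f(2) e(3) r_eq[of x] c_eq[of x] c_eq[OF f(1,5)]
          by (auto simp: L_def in_rl in_cl simp del: One_nat_def split: if_splits)
        then have "sum_list (map A xs) = sum_list (map B xs)"
          using AD by (intro sum_list_map_cong) metis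
        then show ?thesis using B(4) 3 xs(2) by auto
      qed
    qed
    ultimately show ?thesis by (intro exI[of _ A]) auto
  next
    case False
    define D where "D = C - {e}"
    have "D \<subset> C" using eC by (auto simp: D_def)
    obtain B where B: "\<And>x. x \<notin> D \<Longrightarrow> B x = A0 x" "inj_on (\<lambda>x. nrm (B x)) D"
      "(\<lambda>x. nrm (B x)) ` D \<subseteq> T'" "\<forall>x\<in>D. \<forall>xs\<in>L x. sum_list (map B xs) \<noteq> 0"
      using greedy[OF \<open>D \<subset> C\<close>] by blast
    have "card ((\<lambda>x. nrm (B x)) ` D) < card T'"
      using B(2) T'(2) psubset_card_mono[OF finC \<open>D \<subset> C\<close>] by (simp add: card_image)
    then obtain z where z: "z \<in> T'" "z \<notin> (\<lambda>x. nrm (B x)) ` D"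
      using card_mono[of "(\<lambda>x. nrm (B x)) ` D" T'] finC by (auto simp: D_def not_less[symmetric])
    obtain q where q: "\<And>b. sum_list (map (B(e := b)) (col_line E m (snd e))) = 0 \<Longrightarrow> b = q"
      using line_sum_zero_unique[of "col_line E m (snd e)" e B] e by (auto simp: in_cl distinct_lines)
    have zp: "nrm z = z" "z \<noteq> - z" using T'p z by auto
    then obtain b where b: "b \<in> {z, - z}" "b \<noteq> q" by blast
    define A where "A = B(e := b)"
    have nb: "nrm (A e) = z" using b zp nrm_uminus_eq[OF nrm] by (auto simp: A_def)
    have b0: "b \<noteq> 0" using b zp by auto
    have AD: "A x = B x" if "x \<noteq> e" for x using that by (simp add: A_def)
    have CD: "C = insert e D" using eC by (auto simp: D_def)
    have imD: "(\<lambda>x. nrm (A x)) ` D = (\<lambda>x. nrm (B x)) ` D" using AD by (auto simp: D_def image_iff)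
    have "inj_on (\<lambda>x. nrm (A x)) D"
      using B(2) AD by (subst inj_on_cong[of _ _ "\<lambda>x. nrm (B x)"]) (auto simp: D_def)
    moreover have "D - {e} = D" by (simp add: D_def)
    ultimately have "inj_on (\<lambda>x. nrm (A x)) C" "(\<lambda>x. nrm (A x)) ` C \<subseteq> T'"
      using z B(3) by (simp_all add: CD inj_on_insert nb imD)
    moreover have "A x = A0 x" if "x \<in> E - C" for x
      using that B(1)[of x] AD[of x] eC by (auto simp: D_def)
    moreover have "sum_list (map A xs) \<noteq> 0" if xs: "x \<in> C" "xs \<in> L x" for x xs
    proof (cases "x = e")
      case True
      \<comment> \<open>\<open>False\<close> is the outer case: \<open>e\<close> is alone in the
        last row, so the sum of that row is \<open>b\<close> itself.\<close>
      have "x \<in> set (row_line E n (m - 1)) \<longleftrightarrow> x = e" for x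
        using False e by (cases x; cases e) (auto simp: in_rl)
      then have "set (row_line E n (m - 1)) = {e}" by blast
      then have "mset (row_line E n (m - 1)) = {#e#}"
        using distinct_lines(1)[of E n "m - 1"] mset_set_set by fastforce
      then have "row_line E n (m - 1) = [e]" by simp
      then show ?thesis using True xs(2) q b b0 e by (auto simp: L_def A_def split: if_splits)
    next
      case x: False
      have "x \<in> E" using xs(1) by (simp add: C_def)
      then have "e \<notin> set xs"
        using x xs(2) e_eq r_eq[of x] c_eq[of x]
        by (auto simp: L_def in_rl in_cl split: if_splits)
      then have "sum_list (map A xs) = sum_list (map B xs)"
        using AD by (intro sum_list_map_cong) metis
      then show ?thesis using B(4) x xs CD by auto
    qed
    ultimately show ?thesis by (intro exI[of _ A]) auto
  qed
  then obtain A where A: "\<forall>x\<in>E - C. A x = A0 x" "inj_on (\<lambda>x. nrm (A x)) C"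
    "(\<lambda>x. nrm (A x)) ` C \<subseteq> T'" "\<forall>x\<in>C. \<forall>xs\<in>L x. sum_list (map A xs) \<noteq> 0"
    by (elim exE conjE) (rule that)
  \<comment> \<open>Injectivity and equal cardinalities force each reserved value to be used exactly
    once.\<close>
  have "(\<lambda>x. nrm (A x)) ` C = T'"
    using A(2,3) T'(2) finT' by (intro card_subset_eq) (auto simp: card_image)
  then have imC: "image_mset (\<lambda>x. nrm (A x)) (mset_set C) = mset_set T'"
    using image_mset_mset_set[OF A(2)] by simp
  have "image_mset (\<lambda>x. nrm (A x)) (mset_set (E - C)) = image_mset (\<lambda>x. nrm (A0 x)) (mset_set (E - C))"
    using finE A(1) by (intro image_mset_cong) auto
  also have "\<dots> = image_mset nrm (M - mset_set T')"
    unfolding A0[symmetric] by (simp add: multiset.map_comp comp_def)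
  also have "\<dots> = image_mset id (M - mset_set T')"
    using M(2) by (intro image_mset_cong) (auto dest: in_diffD)
  finally have "image_mset (\<lambda>x. nrm (A x)) (mset_set (E - C)) = M - mset_set T'" by simp
  moreover have "mset_set E = mset_set (E - C) + mset_set C"
    using finE by (subst mset_set_Union[symmetric]) (auto simp: C_def intro!: arg_cong[of _ _ mset_set])
  ultimately have "image_mset (\<lambda>x. nrm (A x)) (mset_set E) = M" using imC subM by simp
  moreover have "sum_list (map A (row_line E n i)) \<noteq> 0" if "i < m" for i
    using bspec[OF A(4), of "r i"] r[OF that] by (auto simp: C_def L_def r_def)
  moreover have "sum_list (map A (col_line E m j)) \<noteq> 0" if "j < n" for j
    using bspec[OF A(4), of "c j"] c[OF that] by (auto simp: C_def L_def c_def)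
  ultimately show ?thesis by blast
qed

section \<open>Generalized Heffter arrays\<close>

lemma nonzero_entries_eq:
  "nonzero_entries A = image_mset (\<lambda>c. A $$ c)
    (mset_set {(i, j). i < dim_row A \<and> j < dim_col A \<and> A $$ (i, j) \<noteq> 0})"
proof -
  have "{c \<in> {..<dim_row A} \<times> {..<dim_col A}. A $$ c \<noteq> 0} =
    {(i, j). i < dim_row A \<and> j < dim_col A \<and> A $$ (i, j) \<noteq> 0}" by auto
  then show ?thesis
    unfolding nonzero_entries_def
    by (simp add: filter_mset_image_mset comp_def filter_mset_mset_set case_prod_unfold)
qed

lemma card_split_involutions:
  assumes "finite S"
  shows "card S = card (S - involutions S) + card (involutions S)"
proof -
  have "involutions S \<subseteq> S" by (auto simp: involutions_def)
  then show ?thesis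
    using assms by (metis card_Diff_subset card_mono finite_subset le_add_diff_inverse2)
qed

text \<open>The support of \<open>H\<close> realises the row and column counts, so Gale-Ryser
  applies. Comparing sizes in the multiset identity gives the numerical equation, and the
  multiplicity of a single involution gives the parity of \<open>l\<close>.\<close>

lemma GHA_necessary:
  assumes "GHA nrm l S m n h k H" and len: "length h = m" "length k = n"
    and h_le: "\<And>i. i < m \<Longrightarrow> h ! i \<le> n"
  shows "involutions S \<noteq> {} \<longrightarrow> even l"
    and "real l * real (card S) - real l / 2 * real (card (involutions S)) = real (\<Sum>i<m. h ! i)"
    and "(\<Sum>i<m. h ! i) = (\<Sum>j<n. k ! j)"
    and "\<forall>u. 1 \<le> u \<and> u \<le> n \<longrightarrow> (\<Sum>j<u. rev (sort k) ! j) \<le> (\<Sum>i<m. min (h ! i) u)"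
proof -
  have H: "dim_row H = m" "dim_col H = n" and S: "finite S"
    and eq: "repeat_mset 2 (image_mset nrm (nonzero_entries H)) =
       repeat_mset (2 * l) (mset_set (S - involutions S)) + repeat_mset l (mset_set (involutions S))"
    and row: "\<And>i. i < m \<Longrightarrow> card {j. j < n \<and> H $$ (i, j) \<noteq> 0} = h ! i"
    and col: "\<And>j. j < n \<Longrightarrow> card {i. i < m \<and> H $$ (i, j) \<noteq> 0} = k ! j"
    using assms(1) by (auto simp: GHA_def)
  have finI: "finite (involutions S)"
    using S by (rule rev_finite_subset) (auto simp: involutions_def)
  define E where "E = {(i, j). i < m \<and> j < n \<and> H $$ (i, j) \<noteq> 0}"
  have E: "E \<subseteq> {..<m} \<times> {..<n}" by (auto simp: E_def)
  have rowE: "card {j. (i, j) \<in> E} = h ! i" if "i < m" for i using row[OF that] that by (simp add: E_def)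
  have colE: "card {i. (i, j) \<in> E} = k ! j" if "j < n" for j using col[OF that] that by (simp add: E_def)
  show "(\<Sum>i<m. h ! i) = (\<Sum>j<n. k ! j)"
    "\<forall>u. 1 \<le> u \<and> u \<le> n \<longrightarrow> (\<Sum>j<u. rev (sort k) ! j) \<le> (\<Sum>i<m. min (h ! i) u)"
    using gale_ryser[OF len h_le] E rowE colE by blast+
  have "size (nonzero_entries H) = (\<Sum>i<m. h ! i)"
    using card_eq_sum_rows[OF _ _ E] rowE by (simp add: nonzero_entries_eq H E_def)
  then have "2 * (\<Sum>i<m. h ! i) = 2 * l * card (S - involutions S) + l * card (involutions S)"
    using arg_cong[OF eq, of size] by simp
  then have "real (2 * (\<Sum>i<m. h ! i)) =
      real (2 * l * card (S - involutions S) + l * card (involutions S))" by (simp only:)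
  then show "real l * real (card S) - real l / 2 * real (card (involutions S)) = real (\<Sum>i<m. h ! i)"
    using card_split_involutions[OF S] by (simp add: algebra_simps)
  show "involutions S \<noteq> {} \<longrightarrow> even l"
  proof
    assume "involutions S \<noteq> {}"
    then obtain x where "x \<in> involutions S" by blast
    then have "2 * count (image_mset nrm (nonzero_entries H)) x = l"
      using arg_cong[OF eq, of "\<lambda>M. count M x"] S finI by simp
    then show "even l" by (metis dvd_triv_left)
  qed
qed

section \<open>Existence of nonzero sum arrays with prescribed counts\<close>

theorem theorem1p5:
  fixes nrm :: "'a::group_add \<Rightarrow> 'a" and m n l :: nat and h k :: "nat list" and S :: "'a set"
  assumes "absolute_value nrm"
    and "m > 0" and "n > 0" and "l > 0"
    and "length h = m" and "\<forall>i<m. 1 \<le> h ! i \<and> h ! i \<le> n"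
    and "length k = n" and "\<forall>j<n. 1 \<le> k ! j \<and> k ! j \<le> m"
    and "S \<subseteq> pos_elems nrm"
    and "infinite (S - involutions S) \<or> card (S - involutions S) \<ge> m + n - 1"
  shows "(\<exists>H \<rho> \<gamma>. NGHA nrm l S m n h k H \<rho> \<gamma> \<and> nonzero_sum H \<rho> \<gamma>) \<longleftrightarrow>
    ((involutions S \<noteq> {} \<longrightarrow> even l) \<and>
     finite S \<and>
     real l * real (card S) - real l / 2 * real (card (involutions S)) = real (\<Sum>i<m. h ! i) \<and>
     (\<Sum>i<m. h ! i) = (\<Sum>j<n. k ! j)) \<and>
    (\<forall>u. 1 \<le> u \<and> u \<le> n \<longrightarrow>
       (\<Sum>i<m. min (h ! i) u) \<ge> (\<Sum>j<u. rev (sort k) ! j))"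
proof -
  note nrm = assms(1) and len = assms(5,7)
  have h_le: "h ! i \<le> n" if "i < m" for i using assms(6) that by blast
  show ?thesis (is "?L \<longleftrightarrow> ?R")
  proof
    assume ?L
    then obtain H where H: "GHA nrm l S m n h k H" by (auto simp: NGHA_def)
    then have "finite S" by (simp add: GHA_def)
    then show ?R using GHA_necessary[OF H len h_le] by blast
  next
    assume R: ?R
    then have S: "finite S" by blast
    have finI: "finite (involutions S)"
      using S by (rule rev_finite_subset) (auto simp: involutions_def)
    have even_l: "2 * (l div 2) = l" if "involutions S \<noteq> {}" using R that by simp
    obtain E where E: "E \<subseteq> {..<m} \<times> {..<n}"
      and row: "\<And>i. i < m \<Longrightarrow> card {j. (i, j) \<in> E} = h ! i"
      and col: "\<And>j. j < n \<Longrightarrow> card {i. (i, j) \<in> E} = k ! j"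
      using gale_ryser[OF len h_le] R by blast
    \<comment> \<open>\<open>M\<close> is half of the right side of the identity. The multiplicity
      \<open>l div 2\<close> is exact when there are involutions; otherwise its term is empty and
      \<open>l\<close> may be odd.\<close>
    define M where "M = repeat_mset l (mset_set (S - involutions S)) +
      repeat_mset (l div 2) (mset_set (involutions S))"
    have double_M: "repeat_mset 2 M =
      repeat_mset (2 * l) (mset_set (S - involutions S)) + repeat_mset l (mset_set (involutions S))"
      unfolding M_def using even_l by (cases "involutions S = {}") (auto simp: repeat_mset_distrib)
    have "real (2 * size M) = real (2 * l * card (S - involutions S) + l * card (involutions S))"
      using arg_cong[OF double_M, of size] by simp
    also have "\<dots> = 2 * (real l * real (card S) - real l / 2 * real (card (involutions S)))"
      by (simp add: card_split_involutions[OF S] algebra_simps)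
    also have "real l * real (card S) - real l / 2 * real (card (involutions S)) = real (\<Sum>i<m. h ! i)"
      using R by blast
    also have "(\<Sum>i<m. h ! i) = card E" using card_eq_sum_rows[OF _ _ E] row by simp
    finally have sizeM: "size M = card E" by simp
    have set_M: "x \<in> S" if "x \<in># M" for x
    proof -
      have "x \<in># mset_set (S - involutions S) \<or> x \<in># mset_set (involutions S)"
        using that by (auto simp: M_def count_eq_zero_iff simp flip: count_greater_zero_iff)
      then show ?thesis using S finI by (auto simp: involutions_def)
    qed
    have norm_M: "nrm x = x \<and> x \<noteq> 0" if "x \<in># M" for x
      using nrm_pos_elem[OF nrm, of x] set_M[OF that] assms(9) by blast
    have "\<exists>A. image_mset (\<lambda>c. nrm (A c)) (mset_set E) = M \<and>
      (\<forall>i<m. sum_list (map A (row_line E n i)) \<noteq> 0) \<and> (\<forall>j<n. sum_list (map A (col_line E m j)) \<noteq> 0)"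
    proof (rule nonzero_sum_filling[OF nrm assms(2) E _ _ sizeM])
      show "\<exists>j. (i, j) \<in> E" if "i < m" for i
      proof -
        have "card {j. (i, j) \<in> E} \<noteq> 0" using row[OF that] assms(6) that by auto
        then show ?thesis by (metis (mono_tags) card.empty empty_Collect_eq)
      qed
      show "\<exists>i. (i, j) \<in> E" if "j < n" for j
      proof -
        have "card {i. (i, j) \<in> E} \<noteq> 0" using col[OF that] assms(8) that by auto
        then show ?thesis by (metis (mono_tags) card.empty empty_Collect_eq)
      qed
      \<comment> \<open>Since \<open>l > 0\<close>, every non-involution occurs at least once in
        \<open>M\<close>.\<close>
      show "mset_set (S - involutions S) \<subseteq># M"
        unfolding M_def using assms(4) S by (intro mset_subset_eqI) (auto simp: count_mset_set')
      show "finite (S - involutions S)" using S by simp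
      show "m + n - 1 \<le> card (S - involutions S)" using assms(10) S by simp
      show "t \<noteq> - t" if "t \<in> S - involutions S" for t
        using noninvolution_neq_uminus[OF that] nrm_pos_elem[OF nrm, of t] that assms(9) by blast
    qed (use norm_M in blast)
    then obtain A where A: "image_mset (\<lambda>c. nrm (A c)) (mset_set E) = M"
      "\<And>i. i < m \<Longrightarrow> sum_list (map A (row_line E n i)) \<noteq> 0"
      "\<And>j. j < n \<Longrightarrow> sum_list (map A (col_line E m j)) \<noteq> 0" by blast
    have finE: "finite E" using E by (rule finite_subset) auto
    \<comment> \<open>Nonvanishing on \<open>E\<close> makes the support of the matrix exactly
      \<open>E\<close>, which has the required counts.\<close>
    have A0: "A c \<noteq> 0" if "c \<in> E" for c
    proof -
      have "nrm (A c) \<in># M" unfolding A(1)[symmetric] using that finE by auto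
      then show ?thesis using norm_M nrm_eq_0_iff[OF nrm] by metis
    qed
    define H where "H = mat m n (\<lambda>c. if c \<in> E then A c else 0)"
    have dimH: "dim_row H = m" "dim_col H = n" "H \<in> carrier_mat m n" by (simp_all add: H_def)
    have H: "H $$ c = (if c \<in> E then A c else 0)" if "fst c < m" "snd c < n" for c
      using that by (cases c) (simp add: H_def)
    have H0: "H $$ (i, j) \<noteq> 0 \<longleftrightarrow> (i, j) \<in> E" if "i < m" "j < n" for i j
      using H[of "(i, j)"] that A0 by simp
    have supp: "{(i, j). i < m \<and> j < n \<and> H $$ (i, j) \<noteq> 0} = E" using H0 E by auto
    have "image_mset nrm (nonzero_entries H) = image_mset (\<lambda>c. nrm (H $$ c)) (mset_set E)"
      by (simp add: nonzero_entries_eq dimH supp multiset.map_comp comp_def)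
    also have "\<dots> = M"
      unfolding A(1)[symmetric] using E finE by (intro image_mset_cong) (auto simp: H)
    finally have entries: "image_mset nrm (nonzero_entries H) = M" .
    have "{j. j < n \<and> H $$ (i, j) \<noteq> 0} = {j. (i, j) \<in> E}" if "i < m" for i
      using H0 that E by auto
    moreover have "{i. i < m \<and> H $$ (i, j) \<noteq> 0} = {i. (i, j) \<in> E}" if "j < n" for j
      using H0 that E by auto
    ultimately have GHA: "GHA nrm l S m n h k H"
      using dimH S entries double_M row col by (simp add: GHA_def)
    \<comment> \<open>These are the rotations by 0, which agree with the order of the cells in
      \<open>row_line\<close> and \<open>col_line\<close>.\<close>
    define \<rho> where "\<rho> i = filter (\<lambda>j. H $$ (i, j) \<noteq> 0) [0..<n]" for i
    define \<gamma> where "\<gamma> j = filter (\<lambda>i. H $$ (i, j) \<noteq> 0) [0..<m]" for j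
    have "natural_row_ordering H i (\<rho> i)" "natural_col_ordering H i (\<gamma> i)" for i
      by (auto simp: natural_row_ordering_def natural_col_ordering_def \<rho>_def \<gamma>_def dimH
          intro!: exI[of _ 0])
    then have "NGHA nrm l S m n h k H \<rho> \<gamma>" using GHA by (simp add: NGHA_def natural_ordering_def)
    moreover have "sum_list (map (\<lambda>j. H $$ (i, j)) (\<rho> i)) = sum_list (map A (row_line E n i))"
      if "i < m" for i
    proof -
      have "\<rho> i = filter (\<lambda>j. (i, j) \<in> E) [0..<n]"
        unfolding \<rho>_def using H0 that by (intro filter_cong) auto
      then show ?thesis
        using that by (auto simp: row_line_def H intro!: arg_cong[of _ _ sum_list])
    qed
    moreover have "sum_list (map (\<lambda>i. H $$ (i, j)) (\<gamma> j)) = sum_list (map A (col_line E m j))"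
      if "j < n" for j
    proof -
      have "\<gamma> j = filter (\<lambda>i. (i, j) \<in> E) [0..<m]"
        unfolding \<gamma>_def using H0 that by (intro filter_cong) auto
      then show ?thesis
        using that by (auto simp: col_line_def H intro!: arg_cong[of _ _ sum_list])
    qed
    ultimately show ?L using A(2,3) dimH unfolding nonzero_sum_def by metis
  qed
qed

end
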